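(* For every $n\ge1$ let $\theta_{0,n}\in\Theta_n$ and let $X^n\sim P_{\theta_{0,n},n}$ (planted bi-section model with edge probabilities $p_n,q_n\in(0,1)$), and equip every $\Theta_n$ with its uniform prior. Let $(c_n)$, $c_n\in[0,1]$, satisfy $\liminf_n c_n>0$. Suppose that the posterior recovers the communities exactly, i.e. $\Pi(\{\theta_{0,n}\}|X^n)\to1$ in $P_{\theta_{0,n},n}$-probability. Then any sequence $(D_n)$ of ($P_n^{\Pi}$-almost-sure) credible sets of levels $c_n$ satisfies $$P_{\theta_{0,n},n}\bigl(\theta_{0,n}\in D_n(X^n)\bigr)\to1\qquad(n\to\infty),$$ i.e. $(D_n)$ is a consistent sequence of confidence sets. Moreover, credible sets of levels $c_n$ of minimal order (cardinality), or of minimal diameter, equal $\{\theta_{0,n}\}$ with $P_{\theta_{0,n},n}$-probability tending to one.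
   Context: Planted bi-section model. For $n\ge1$, $\Theta_n'$ is the set of $\theta'\in\{0,1\}^{2n}$ with exactly $n$ zeros and $n$ ones. Let $\neg\theta'$ denote component-wise negation, let $\sim_n$ be the equivalence relation identifying $\theta'$ with $\neg\theta'$, and let $\Theta_n=\Theta_n'/\sim_n$. Given $p_n,q_n\in(0,1)$ and $\theta\in\Theta_n$ with representative $\theta'$, $P_{\theta,n}$ is the law of the random simple undirected graph $X^n$ (no loops) on vertices $\{1,\dots,2n\}$, with adjacency indicators $X_{ij}$ ($i<j$), whose edges occur independently with $P_{\theta,n}(X_{ij}=1)=p_n$ if $\theta'_i=\theta'_j$ and $=q_n$ if $\theta'_i\ne\theta'_j$ (independent of the representative). $\mathscr X_n$ is the finite set of such graphs. Let $p_{\theta,n}(x^n)=P_{\theta,n}(X^n=x^n)$. With the uniform prior on $\Theta_n$, the posterior is, for $A\subset\Theta_n$, $$\Pi(A|X^n)=\sum_{\theta\in A}p_{\theta,n}(X^n)\Big/\sum_{\theta\in\Theta_n}p_{\theta,n}(X^n),$$ and $P_n^{\Pi}=|\Theta_n|^{-1}\sum_{\theta\in\Theta_n}P_{\theta,n}$ is the prior predictive distribution. A sequence of credible sets of levels $c_n$ is a sequence of set-valued maps $D_n$ from $\mathscr X_n$ to subsets of $\Theta_n$ with $\Pi(D_n(X^n)|X^n)\ge c_n$, $P_n^\Pi$-almost-surely. Metric on $\Theta_n$: with $Z(\theta')=\{i:\theta'_i=0\}$, $k'(\theta_1',\theta_2')=|Z(\theta_1')\setminus Z(\theta_2')|$,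 and $k(\theta_1,\theta_2)=\min\{k'(\theta_1',\theta_2'),k'(\theta_1',\neg\theta_2')\}$ for representatives $\theta_i'$ of $\theta_i$. The diameter of $C\subset\Theta_n$ is $\max\{k(\theta,\eta):\theta,\eta\in C\}$.
   Formalization: The "Moreover" claim fails for levels such as c_n = 1 (the only credible set is then Θ_n); it is proved assuming limsup c_n < 1, or that Π({θ_{0,n}}|X^n) ≥ c_n with P_{θ_{0,n},n}-probability tending to one, which is also necessary. *)

theory Defs
  imports "HOL-Probability.Probability"
begin

section \<open>Community assignments\<close>

text \<open>A vector in {0,1}^(2n) is a function that is extensional on {1..2n}.\<close>

type_synonym labelling = "nat \<Rightarrow> nat"

definition zeros :: "nat \<Rightarrow> labelling \<Rightarrow> nat set" where
  "zeros n t = {i \<in> {1..2*n}. t i = 0}"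

definition ones :: "nat \<Rightarrow> labelling \<Rightarrow> nat set" where
  "ones n t = {i \<in> {1..2*n}. t i = 1}"

definition Theta' :: "nat \<Rightarrow> labelling set" where
  "Theta' n = {t \<in> {1..2*n} \<rightarrow>\<^sub>E {0, 1}. card (zeros n t) = n \<and> card (ones n t) = n}"

definition neg :: "nat \<Rightarrow> labelling \<Rightarrow> labelling" where
  "neg n t = (\<lambda>i\<in>{1..2*n}. 1 - t i)"

definition sim :: "nat \<Rightarrow> (labelling \<times> labelling) set" where
  "sim n = {(s, t). s \<in> Theta' n \<and> t \<in> Theta' n \<and> (s = t \<or> s = neg n t)}"

definition Theta :: "nat \<Rightarrow> labelling set set" where
  "Theta n = Theta' n // sim n"

text \<open>Quantities on equivalence classes are evaluated at a chosen representative; the lemmas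
  \<open>graph_law_class\<close> and \<open>cdist_class\<close> below show that the choice is immaterial.\<close>

definition rep :: "labelling set \<Rightarrow> labelling" where
  "rep \<theta> = (SOME t. t \<in> \<theta>)"

definition cdist' :: "nat \<Rightarrow> labelling \<Rightarrow> labelling \<Rightarrow> nat" where
  "cdist' n s t = card (zeros n s - zeros n t)"

definition cdist :: "nat \<Rightarrow> labelling set \<Rightarrow> labelling set \<Rightarrow> nat" where
  "cdist n \<theta> \<eta> = min (cdist' n (rep \<theta>) (rep \<eta>)) (cdist' n (rep \<theta>) (neg n (rep \<eta>)))"

text \<open>The empty set is given diameter 0.\<close>

definition diam :: "nat \<Rightarrow> labelling set set \<Rightarrow> nat" where
  "diam n C = (if C = {} then 0 else Max {cdist n \<theta> \<eta> | \<theta> \<eta>. \<theta> \<in> C \<and> \<eta> \<in> C})"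

section \<open>The planted bi-section model\<close>

text \<open>A simple undirected graph on {1..2n} is given by its adjacency indicators at the pairs
  (i, j) with i < j; the indicators are set to False at all other pairs.\<close>

type_synonym graph = "nat \<times> nat \<Rightarrow> bool"

definition vpairs :: "nat \<Rightarrow> (nat \<times> nat) set" where
  "vpairs n = {(i, j). 1 \<le> i \<and> i < j \<and> j \<le> 2*n}"

definition graphs :: "nat \<Rightarrow> graph set" where
  "graphs n = PiE_dflt (vpairs n) False (\<lambda>_. UNIV)"

definition graph_law' :: "nat \<Rightarrow> real \<Rightarrow> real \<Rightarrow> labelling \<Rightarrow> graph pmf" where
  "graph_law' n p q t = Pi_pmf (vpairs n) False (\<lambda>(i, j). bernoulli_pmf (if t i = t j then p else q))"

definition graph_law :: "nat \<Rightarrow> real \<Rightarrow> real \<Rightarrow> labelling set \<Rightarrow> graph pmf" where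
  "graph_law n p q \<theta> = graph_law' n p q (rep \<theta>)"

section \<open>Posterior and credible sets\<close>

definition posterior :: "nat \<Rightarrow> real \<Rightarrow> real \<Rightarrow> graph \<Rightarrow> labelling set set \<Rightarrow> real" where
  "posterior n p q x A = (\<Sum>\<theta>\<in>A. pmf (graph_law n p q \<theta>) x) / (\<Sum>\<theta>\<in>Theta n. pmf (graph_law n p q \<theta>) x)"

text \<open>The mixture of the laws \<open>graph_law n p q \<theta>\<close> under the uniform prior; \<open>pmf_prior_predictive\<close> below
  gives it as an average.\<close>

definition prior_predictive :: "nat \<Rightarrow> real \<Rightarrow> real \<Rightarrow> graph pmf" where
  "prior_predictive n p q = bind_pmf (pmf_of_set (Theta n)) (graph_law n p q)"

definition credible :: "nat \<Rightarrow> real \<Rightarrow> real \<Rightarrow> real \<Rightarrow> (graph \<Rightarrow> labelling set set) \<Rightarrow> bool" where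
  "credible n p q c D \<longleftrightarrow>
     (\<forall>x\<in>graphs n. D x \<subseteq> Theta n) \<and>
     (AE x in measure_pmf (prior_predictive n p q). posterior n p q x (D x) \<ge> c)"

definition min_order_credible ::
    "nat \<Rightarrow> real \<Rightarrow> real \<Rightarrow> real \<Rightarrow> (graph \<Rightarrow> labelling set set) \<Rightarrow> bool" where
  "min_order_credible n p q c D \<longleftrightarrow>
     credible n p q c D \<and>
     (AE x in measure_pmf (prior_predictive n p q).
        \<forall>A. A \<subseteq> Theta n \<and> posterior n p q x A \<ge> c \<longrightarrow> card (D x) \<le> card A)"

definition min_diam_credible ::
    "nat \<Rightarrow> real \<Rightarrow> real \<Rightarrow> real \<Rightarrow> (graph \<Rightarrow> labelling set set) \<Rightarrow> bool" where
  "min_diam_credible n p q c D \<longleftrightarrow>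
     credible n p q c D \<and>
     (AE x in measure_pmf (prior_predictive n p q).
        \<forall>A. A \<subseteq> Theta n \<and> posterior n p q x A \<ge> c \<longrightarrow> diam n (D x) \<le> diam n A)"

section \<open>Well-definedness\<close>

lemma finite_Theta': "finite (Theta' n)"
  by (rule finite_subset[of _ "{1..2*n} \<rightarrow>\<^sub>E {0, 1}"])
     (auto simp: Theta'_def intro!: finite_PiE)

lemma Theta'_val: "t \<in> Theta' n \<Longrightarrow> i \<in> {1..2*n} \<Longrightarrow> t i = 0 \<or> t i = 1"
  by (auto simp: Theta'_def PiE_iff)

lemma zeros_neg: "t \<in> Theta' n \<Longrightarrow> zeros n (neg n t) = ones n t"
  using Theta'_val[of t n] by (fastforce simp: zeros_def ones_def neg_def)

lemma ones_neg: "t \<in> Theta' n \<Longrightarrow> ones n (neg n t) = zeros n t"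
  using Theta'_val[of t n] by (fastforce simp: zeros_def ones_def neg_def)

lemma neg_in: "t \<in> Theta' n \<Longrightarrow> neg n t \<in> Theta' n"
  using zeros_neg[of t n] ones_neg[of t n] Theta'_val[of t n]
  by (auto simp: Theta'_def neg_def)

lemma neg_neg: "t \<in> Theta' n \<Longrightarrow> neg n (neg n t) = t"
proof (rule ext)
  fix i assume t: "t \<in> Theta' n"
  then have "t \<in> extensional {1..2*n}" by (auto simp: Theta'_def PiE_def)
  then show "neg n (neg n t) i = t i"
    using Theta'_val[OF t, of i]
    by (cases "i \<in> {1..2*n}") (auto simp: neg_def extensional_def)
qed

lemma equiv_sim: "equiv (Theta' n) (sim n)"
proof (rule equivI)
  show "sim n \<subseteq> Theta' n \<times> Theta' n" by (auto simp: sim_def)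
  show "refl_on (Theta' n) (sim n)" by (auto simp: refl_on_def sim_def)
  show "sym (sim n)" by (auto simp: sym_def sim_def neg_neg)
  show "trans (sim n)" by (auto simp: trans_def sim_def neg_neg)
qed

lemma sim_class: "t \<in> Theta' n \<Longrightarrow> sim n `` {t} = {t, neg n t}"
  by (auto simp: sim_def neg_in neg_neg)

lemma rep_class: "t \<in> Theta' n \<Longrightarrow> rep (sim n `` {t}) \<in> {t, neg n t}"
  unfolding rep_def by (rule someI2[of _ t]) (auto simp: sim_class)

lemma graph_law'_neg:
  assumes "t \<in> Theta' n" shows "graph_law' n p q (neg n t) = graph_law' n p q t"
  unfolding graph_law'_def
proof (rule Pi_pmf_cong)
  fix e assume "e \<in> vpairs n"
  then obtain i j where e: "e = (i, j)" "i \<in> {1..2*n}" "j \<in> {1..2*n}"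
    by (auto simp: vpairs_def)
  then have "(neg n t i = neg n t j) = (t i = t j)"
    using Theta'_val[OF assms, of i] Theta'_val[OF assms, of j] by (auto simp: neg_def)
  then show "(case e of (i, j) \<Rightarrow> bernoulli_pmf (if neg n t i = neg n t j then p else q)) =
             (case e of (i, j) \<Rightarrow> bernoulli_pmf (if t i = t j then p else q))"
    using e by simp
qed auto

lemma graph_law_class: "t \<in> Theta' n \<Longrightarrow> graph_law n p q (sim n `` {t}) = graph_law' n p q t"
  using rep_class[of t n] graph_law'_neg[of t n p q] by (auto simp: graph_law_def)

lemma cdist'_neg_neg:
  assumes s: "s \<in> Theta' n" and t: "t \<in> Theta' n"
  shows "cdist' n (neg n s) (neg n t) = cdist' n s t"
proof -
  have fin: "finite (zeros n s)" "finite (zeros n t)" by (auto simp: zeros_def)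
  have "ones n s - ones n t = zeros n t - zeros n s"
    using Theta'_val[OF s] Theta'_val[OF t] by (fastforce simp: zeros_def ones_def)
  moreover have "card (zeros n t) = card (zeros n s)"
    using s t by (auto simp: Theta'_def)
  then have "card (zeros n t - zeros n s) = card (zeros n s - zeros n t)"
    using fin by (simp add: card_Diff_subset_Int Int_commute)
  ultimately show ?thesis by (simp add: cdist'_def zeros_neg s t)
qed

lemma cdist_class:
  assumes s: "s \<in> Theta' n" and t: "t \<in> Theta' n"
  shows "cdist n (sim n `` {s}) (sim n `` {t}) = min (cdist' n s t) (cdist' n s (neg n t))"
proof -
  have *: "cdist' n (neg n s) t = cdist' n s (neg n t)"
    using cdist'_neg_neg[OF s neg_in[OF t]] by (simp add: neg_neg t)
  show ?thesis
    using rep_class[OF s] rep_class[OF t] cdist'_neg_neg[OF s t] *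
    by (auto simp: cdist_def neg_neg s t min.commute)
qed

lemma finite_Theta: "finite (Theta n)"
  unfolding Theta_def by (rule finite_quotient[OF finite_Theta']) (auto simp: sim_def)

lemma Theta_nonempty: "Theta n \<noteq> {}"
proof -
  define t :: labelling where "t = (\<lambda>i\<in>{1..2*n}. if i \<le> n then 0 else 1)"
  have "zeros n t = {1..n}" "ones n t = {n<..2*n}"
    by (auto simp: zeros_def ones_def t_def)
  then have "t \<in> Theta' n" by (auto simp: Theta'_def t_def)
  then show ?thesis by (auto simp: Theta_def quotient_def)
qed

lemma pmf_prior_predictive:
  "pmf (prior_predictive n p q) x = (\<Sum>\<theta>\<in>Theta n. pmf (graph_law n p q \<theta>) x) / real (card (Theta n))"
  unfolding prior_predictive_def pmf_bind
  by (subst integral_pmf_of_set[OF Theta_nonempty finite_Theta]) simp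

end

theory Submission
  imports Defs
begin

text \<open>
  Posterior masses of disjoint sets add up to at most 1, so once the posterior puts mass at least
  \<open>1 - a\<close> on the true assignment, every set of posterior mass exceeding \<open>a\<close> must contain that
  assignment (\<open>heavy_set_contains_heavy_point\<close>). Take for \<open>a\<close> a positive eventual lower bound of
  the levels: exact recovery makes the first condition hold with probability tending to one, and
  credibility gives the second. Credibility is only known almost surely under the prior
  predictive law, but this law is a finite mixture with \<open>graph_law n p q \<theta>0\<close> among its components, so
  the almost sure statement carries over to the true law (\<open>AE_prior_predictiveD\<close>).

  For credible sets of minimal size, compare with \<open>{\<theta>0}\<close>. Whenever the singleton
  itself reaches the level, a minimal set has at most one element, respectively diameter 0. Since
  \<open>cdist\<close> separates points, in both cases the set is contained in a singleton, and by the first part it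
  contains \<open>\<theta>0\<close>. That the singleton reaches the level with probability tending to one is either
  assumed or follows from exact recovery when the levels stay eventually below some \<open>b < 1\<close>.
\<close>

section \<open>Events of probability tending to one\<close>

text \<open>Comparing the events on the support only is what lets almost sure properties of credible sets
  enter below.\<close>

lemma prob_tendsto_one_mono:
  fixes M :: "nat \<Rightarrow> 'a pmf"
  assumes A: "(\<lambda>n. measure_pmf.prob (M n) (A n)) \<longlonglongrightarrow> 1"
    and sub: "\<forall>\<^sub>F n in sequentially. A n \<inter> set_pmf (M n) \<subseteq> B n"
  shows "(\<lambda>n. measure_pmf.prob (M n) (B n)) \<longlonglongrightarrow> 1"
proof (rule tendsto_sandwich[OF _ _ A tendsto_const])
  show "\<forall>\<^sub>F n in sequentially. measure_pmf.prob (M n) (A n) \<le> measure_pmf.prob (M n) (B n)"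
    using sub
  proof eventually_elim
    case (elim n)
    have "measure_pmf.prob (M n) (A n) = measure_pmf.prob (M n) (A n \<inter> set_pmf (M n))"
      by (rule measure_Int_set_pmf[symmetric])
    also have "\<dots> \<le> measure_pmf.prob (M n) (B n)"
      using elim by (intro measure_pmf.finite_measure_mono) auto
    finally show ?case .
  qed
qed simp

lemma prob_tendsto_one_Int:
  fixes M :: "nat \<Rightarrow> 'a pmf"
  assumes A: "(\<lambda>n. measure_pmf.prob (M n) (A n)) \<longlonglongrightarrow> 1"
    and B: "(\<lambda>n. measure_pmf.prob (M n) (B n)) \<longlonglongrightarrow> 1"
  shows "(\<lambda>n. measure_pmf.prob (M n) (A n \<inter> B n)) \<longlonglongrightarrow> 1"
proof (rule tendsto_sandwich[OF _ _ _ tendsto_const])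
  have "measure_pmf.prob (M n) (A n) + measure_pmf.prob (M n) (B n) - 1
      \<le> measure_pmf.prob (M n) (A n \<inter> B n)" for n
  proof -
    have "measure_pmf.prob (M n) (A n) + measure_pmf.prob (M n) (B n)
        = measure_pmf.prob (M n) (A n \<union> B n) + measure_pmf.prob (M n) (A n \<inter> B n)"
      using measure_Un3[of "A n" "measure_pmf (M n)" "B n"]
      by (simp add: fmeasurableI measure_pmf.fmeasurable_eq_sets)
    then show ?thesis
      using measure_pmf.prob_le_1[of "M n" "A n \<union> B n"] by linarith
  qed
  then show "\<forall>\<^sub>F n in sequentially.
      measure_pmf.prob (M n) (A n) + measure_pmf.prob (M n) (B n) - 1
      \<le> measure_pmf.prob (M n) (A n \<inter> B n)"
    by simp
  show "(\<lambda>n. measure_pmf.prob (M n) (A n) + measure_pmf.prob (M n) (B n) - 1) \<longlonglongrightarrow> 1"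
    using tendsto_diff[OF tendsto_add[OF A B] tendsto_const[of 1]] by simp
qed simp

lemma prob_tendsto_one_of_dist:
  fixes M :: "nat \<Rightarrow> 'a pmf" and f :: "nat \<Rightarrow> 'a \<Rightarrow> real"
  assumes "(\<lambda>n. measure_pmf.prob (M n) {x. dist (f n x) 1 > \<epsilon>}) \<longlonglongrightarrow> 0"
  shows "(\<lambda>n. measure_pmf.prob (M n) {x. f n x \<ge> 1 - \<epsilon>}) \<longlonglongrightarrow> 1"
proof -
  have "measure_pmf.prob (M n) (- {x. dist (f n x) 1 > \<epsilon>})
      = 1 - measure_pmf.prob (M n) {x. dist (f n x) 1 > \<epsilon>}" for n
    using measure_pmf.prob_compl[of "{x. dist (f n x) 1 > \<epsilon>}" "M n"]
    by (simp add: Compl_eq_Diff_UNIV)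
  then have "(\<lambda>n. measure_pmf.prob (M n) (- {x. dist (f n x) 1 > \<epsilon>})) \<longlonglongrightarrow> 1"
    using tendsto_diff[OF tendsto_const[of 1] assms] by simp
  then show ?thesis
    by (rule prob_tendsto_one_mono, intro always_eventually allI) (auto simp: dist_real_def)
qed

section \<open>Distances and diameters of sets of assignments\<close>

lemma Theta'_eqI_zeros:
  assumes s: "s \<in> Theta' n" and t: "t \<in> Theta' n" and z: "zeros n s = zeros n t"
  shows "s = t"
proof (rule extensionalityI[of _ "{1..2*n}"])
  fix i assume i: "i \<in> {1..2*n}"
  have "s i = 0 \<longleftrightarrow> t i = 0" using z i by (auto simp: zeros_def set_eq_iff)
  then show "s i = t i" using Theta'_val[OF s i] Theta'_val[OF t i] by auto
qed (use s t in \<open>auto simp: Theta'_def PiE_def\<close>)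

text \<open>All zero sets have the same cardinality \<open>n\<close>, so a one-sided inclusion between two of them is
  already an equality.\<close>

lemma cdist'_eq_0_iff:
  assumes s: "s \<in> Theta' n" and t: "t \<in> Theta' n"
  shows "cdist' n s t = 0 \<longleftrightarrow> s = t"
proof
  have fin: "finite (zeros n s)" "finite (zeros n t)" by (auto simp: zeros_def)
  assume "cdist' n s t = 0"
  then have "zeros n s \<subseteq> zeros n t" using fin by (simp add: cdist'_def)
  moreover have "card (zeros n s) = card (zeros n t)" using s t by (simp add: Theta'_def)
  ultimately have "zeros n s = zeros n t" using fin by (simp add: card_subset_eq)
  then show "s = t" by (rule Theta'_eqI_zeros[OF s t])
qed (simp add: cdist'_def)

lemma cdist_eq_0_iff:
  assumes "\<theta> \<in> Theta n" and "\<eta> \<in> Theta n"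
  shows "cdist n \<theta> \<eta> = 0 \<longleftrightarrow> \<theta> = \<eta>"
proof -
  obtain s t where s: "s \<in> Theta' n" "\<theta> = sim n `` {s}" and t: "t \<in> Theta' n" "\<eta> = sim n `` {t}"
    using assms by (auto simp: Theta_def quotient_def)
  have "cdist n \<theta> \<eta> = 0 \<longleftrightarrow> s = t \<or> s = neg n t"
    using s t cdist'_eq_0_iff[of s n t] cdist'_eq_0_iff[of s n "neg n t"]
    by (auto simp: cdist_class neg_in min_def)
  also have "\<dots> \<longleftrightarrow> \<theta> = \<eta>"
    using s t eq_equiv_class_iff[OF equiv_sim s(1) t(1)] by (auto simp: sim_def)
  finally show ?thesis .
qed

lemma diam_singleton: "\<theta> \<in> Theta n \<Longrightarrow> diam n {\<theta>} = 0"
  by (simp add: diam_def cdist_eq_0_iff)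

lemma cdist_le_diam:
  assumes "C \<subseteq> Theta n" and "\<theta> \<in> C" and "\<eta> \<in> C"
  shows "cdist n \<theta> \<eta> \<le> diam n C"
proof -
  have "{cdist n \<theta> \<eta> | \<theta> \<eta>. \<theta> \<in> C \<and> \<eta> \<in> C} = (\<lambda>(\<theta>, \<eta>). cdist n \<theta> \<eta>) ` (C \<times> C)"
    by auto
  then have "finite {cdist n \<theta> \<eta> | \<theta> \<eta>. \<theta> \<in> C \<and> \<eta> \<in> C}"
    using finite_subset[OF assms(1) finite_Theta] by simp
  then show ?thesis
    using assms(2,3) by (auto simp: diam_def intro!: Max_ge)
qed

lemma diam_eq_0_imp_singleton:
  assumes C: "C \<subseteq> Theta n" and \<theta>: "\<theta> \<in> C" and "diam n C = 0"
  shows "C = {\<theta>}"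
proof -
  have "\<eta> = \<theta>" if "\<eta> \<in> C" for \<eta>
  proof -
    have "cdist n \<theta> \<eta> = 0" using cdist_le_diam[OF C \<theta> that] assms(3) by simp
    then show ?thesis using cdist_eq_0_iff[OF subsetD[OF C \<theta>] subsetD[OF C that]] by simp
  qed
  then show ?thesis using \<theta> by blast
qed

section \<open>Posterior mass and credible sets\<close>

lemma set_pmf_graph_law: "set_pmf (graph_law n p q \<theta>) \<subseteq> graphs n"
proof -
  have "finite (vpairs n)"
    by (rule finite_subset[of _ "{..2*n} \<times> {..2*n}"]) (auto simp: vpairs_def)
  from set_Pi_pmf_subset'[OF this] show ?thesis
    unfolding graph_law_def graph_law'_def graphs_def by (rule order.trans) (auto simp: PiE_dflt_def)
qed

text \<open>The support of the uniform mixture is the union of the supports of its components, and almost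
  surely under a discrete law means everywhere on its support.\<close>

lemma AE_prior_predictiveD:
  assumes "AE x in measure_pmf (prior_predictive n p q). P x"
    and "\<theta> \<in> Theta n" and "x \<in> set_pmf (graph_law n p q \<theta>)"
  shows "P x"
proof -
  have "x \<in> set_pmf (prior_predictive n p q)"
    using assms(2,3) unfolding prior_predictive_def set_bind_pmf
      set_pmf_of_set[OF Theta_nonempty finite_Theta] by blast
  then show ?thesis using assms(1) unfolding AE_measure_pmf_iff by blast
qed

text \<open>If the data have probability 0 under every assignment, the quotient defining \<open>posterior\<close> is 0,
  so the bound by 1 holds for every graph.\<close>

lemma posterior_le_1:
  assumes "A \<subseteq> Theta n" shows "posterior n p q x A \<le> 1"
proof -
  have "(\<Sum>\<theta>\<in>A. pmf (graph_law n p q \<theta>) x) \<le> (\<Sum>\<theta>\<in>Theta n. pmf (graph_law n p q \<theta>) x)"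
    by (rule sum_mono2[OF finite_Theta assms]) simp
  moreover have "0 \<le> (\<Sum>\<theta>\<in>Theta n. pmf (graph_law n p q \<theta>) x)"
    by (rule sum_nonneg) simp
  ultimately show ?thesis
    unfolding posterior_def divide_le_eq_1 by (metis order_le_less)
qed

lemma posterior_insert:
  assumes "A \<subseteq> Theta n" and "\<theta> \<notin> A"
  shows "posterior n p q x (insert \<theta> A) = posterior n p q x {\<theta>} + posterior n p q x A"
  using assms finite_subset[OF assms(1) finite_Theta]
  by (simp add: posterior_def add_divide_distrib)

text \<open>Otherwise \<open>A\<close> and \<open>{\<theta>}\<close> would be disjoint with total mass exceeding 1.\<close>

lemma heavy_set_contains_heavy_point:
  assumes "A \<subseteq> Theta n" and "\<theta> \<in> Theta n"
    and "posterior n p q x {\<theta>} \<ge> 1 - a" and "posterior n p q x A > a"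
  shows "\<theta> \<in> A"
proof (rule ccontr)
  assume "\<theta> \<notin> A"
  then have "posterior n p q x {\<theta>} + posterior n p q x A \<le> 1"
    using posterior_insert[OF assms(1)] posterior_le_1[of "insert \<theta> A" n] assms(1,2) by simp
  with assms(3,4) show False by simp
qed

lemma credibleD:
  assumes "credible n p q c D" and "\<theta> \<in> Theta n" and "x \<in> set_pmf (graph_law n p q \<theta>)"
  shows "D x \<subseteq> Theta n" and "posterior n p q x (D x) \<ge> c"
proof -
  note cred = assms(1)[unfolded credible_def]
  show "D x \<subseteq> Theta n" using cred set_pmf_graph_law assms(3) by blast
  show "posterior n p q x (D x) \<ge> c" by (rule AE_prior_predictiveD[OF conjunct2[OF cred] assms(2,3)])
qed

text \<open>The singleton \<open>{\<theta>}\<close> competes in the minimisation as soon as its posterior mass reaches the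
  level, which bounds the cardinality by 1 or the diameter by 0.\<close>

lemma minimal_credible_eq_singleton:
  assumes min: "min_order_credible n p q c D \<or> min_diam_credible n p q c D"
    and \<theta>: "\<theta> \<in> Theta n" and x: "x \<in> set_pmf (graph_law n p q \<theta>)"
    and level: "posterior n p q x {\<theta>} \<ge> c" and mem: "\<theta> \<in> D x"
  shows "D x = {\<theta>}"
  using min
proof
  assume *: "min_order_credible n p q c D"
  then have sub: "D x \<subseteq> Theta n"
    using credibleD(1)[OF _ \<theta> x] unfolding min_order_credible_def by blast
  have "\<forall>A. A \<subseteq> Theta n \<and> posterior n p q x A \<ge> c \<longrightarrow> card (D x) \<le> card A"
    by (rule AE_prior_predictiveD[OF conjunct2[OF *[unfolded min_order_credible_def]] \<theta> x])
  from spec[OF this, of "{\<theta>}"] have "card (D x) \<le> card {\<theta>}" using level \<theta> by simp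
  then show ?thesis
    using card_seteq[OF finite_subset[OF sub finite_Theta], of "{\<theta>}"] mem by simp
next
  assume *: "min_diam_credible n p q c D"
  then have sub: "D x \<subseteq> Theta n"
    using credibleD(1)[OF _ \<theta> x] unfolding min_diam_credible_def by blast
  have "\<forall>A. A \<subseteq> Theta n \<and> posterior n p q x A \<ge> c \<longrightarrow> diam n (D x) \<le> diam n A"
    by (rule AE_prior_predictiveD[OF conjunct2[OF *[unfolded min_diam_credible_def]] \<theta> x])
  from spec[OF this, of "{\<theta>}"] have "diam n (D x) \<le> diam n {\<theta>}" using level \<theta> by simp
  then show ?thesis
    using diam_eq_0_imp_singleton[OF sub mem] diam_singleton[OF \<theta>] by simp
qed

section \<open>Credible sets as confidence sets\<close>

theorem theorem4p1:
  fixes p q c :: "nat \<Rightarrow> real" and \<theta>0 :: "nat \<Rightarrow> labelling set"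
  assumes "\<And>n. n \<ge> 1 \<Longrightarrow> 0 < p n \<and> p n < 1"
    and "\<And>n. n \<ge> 1 \<Longrightarrow> 0 < q n \<and> q n < 1"
    and "\<And>n. n \<ge> 1 \<Longrightarrow> \<theta>0 n \<in> Theta n"
    and "\<And>n. n \<ge> 1 \<Longrightarrow> 0 \<le> c n \<and> c n \<le> 1"
    and "liminf (\<lambda>n. ereal (c n)) > 0"
    and exact_recovery: "\<And>\<epsilon>::real. \<epsilon> > 0 \<Longrightarrow>
      (\<lambda>n. measure_pmf.prob (graph_law n (p n) (q n) (\<theta>0 n))
             {x. dist (posterior n (p n) (q n) x {\<theta>0 n}) 1 > \<epsilon>}) \<longlonglongrightarrow> 0"
  shows "(\<forall>D. (\<forall>n\<ge>1. credible n (p n) (q n) (c n) (D n)) \<longrightarrow>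
           (\<lambda>n. measure_pmf.prob (graph_law n (p n) (q n) (\<theta>0 n)) {x. \<theta>0 n \<in> D n x}) \<longlonglongrightarrow> 1) \<and>
         (limsup (\<lambda>n. ereal (c n)) < 1 \<or>
          (\<lambda>n. measure_pmf.prob (graph_law n (p n) (q n) (\<theta>0 n))
                 {x. posterior n (p n) (q n) x {\<theta>0 n} \<ge> c n}) \<longlonglongrightarrow> 1 \<longrightarrow>
          (\<forall>D. (\<forall>n\<ge>1. min_order_credible n (p n) (q n) (c n) (D n)) \<or>
               (\<forall>n\<ge>1. min_diam_credible n (p n) (q n) (c n) (D n)) \<longrightarrow>
             (\<lambda>n. measure_pmf.prob (graph_law n (p n) (q n) (\<theta>0 n)) {x. D n x = {\<theta>0 n}}) \<longlonglongrightarrow> 1))"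
proof -
  let ?P = "\<lambda>n. graph_law n (p n) (q n) (\<theta>0 n)"
  let ?post = "\<lambda>n x. posterior n (p n) (q n) x"
  have recovery: "(\<lambda>n. measure_pmf.prob (?P n) {x. ?post n x {\<theta>0 n} \<ge> 1 - \<epsilon>}) \<longlonglongrightarrow> 1"
    if "\<epsilon> > 0" for \<epsilon>
    using exact_recovery[OF that] by (rule prob_tendsto_one_of_dist)
  have coverage: "(\<lambda>n. measure_pmf.prob (?P n) {x. \<theta>0 n \<in> D n x}) \<longlonglongrightarrow> 1"
    if D: "\<forall>n\<ge>1. credible n (p n) (q n) (c n) (D n)" for D
  proof -
    obtain a where a: "0 < ereal a" "ereal a < liminf (\<lambda>n. ereal (c n))"
      using ereal_dense2[OF assms(5)] by blast
    from less_LiminfD[OF a(2)] have "\<forall>\<^sub>F n in sequentially. a < c n" by simp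
    then have "\<forall>\<^sub>F n in sequentially.
        {x. ?post n x {\<theta>0 n} \<ge> 1 - a} \<inter> set_pmf (?P n) \<subseteq> {x. \<theta>0 n \<in> D n x}"
      using eventually_ge_at_top[of 1]
    proof eventually_elim
      case (elim n)
      note \<theta> = assms(3)[OF elim(2)]
      show ?case
      proof safe
        fix x assume "?post n x {\<theta>0 n} \<ge> 1 - a" and x: "x \<in> set_pmf (?P n)"
        then show "\<theta>0 n \<in> D n x"
          using credibleD[OF D[rule_format, OF elim(2)] \<theta> x] elim(1)
          by (intro heavy_set_contains_heavy_point[OF _ \<theta>]) auto
      qed
    qed
    moreover have "0 < a" using a(1) by simp
    ultimately show ?thesis by (rule prob_tendsto_one_mono[OF recovery, rotated])
  qed
  have minimal: "(\<lambda>n. measure_pmf.prob (?P n) {x. D n x = {\<theta>0 n}}) \<longlonglongrightarrow> 1"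
    if level: "limsup (\<lambda>n. ereal (c n)) < 1 \<or>
        (\<lambda>n. measure_pmf.prob (?P n) {x. ?post n x {\<theta>0 n} \<ge> c n}) \<longlonglongrightarrow> 1"
      and D: "(\<forall>n\<ge>1. min_order_credible n (p n) (q n) (c n) (D n)) \<or>
        (\<forall>n\<ge>1. min_diam_credible n (p n) (q n) (c n) (D n))" for D
  proof -
    have reach: "(\<lambda>n. measure_pmf.prob (?P n) {x. ?post n x {\<theta>0 n} \<ge> c n}) \<longlonglongrightarrow> 1"
      using level
    proof
      assume "limsup (\<lambda>n. ereal (c n)) < 1"
      then obtain b where b: "limsup (\<lambda>n. ereal (c n)) < ereal b" "ereal b < 1"
        using ereal_dense2 by blast
      from Limsup_lessD[OF b(1)] have "\<forall>\<^sub>F n in sequentially. c n < b" by simp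
      then have "\<forall>\<^sub>F n in sequentially.
          {x. ?post n x {\<theta>0 n} \<ge> 1 - (1 - b)} \<inter> set_pmf (?P n) \<subseteq> {x. ?post n x {\<theta>0 n} \<ge> c n}"
        by eventually_elim auto
      moreover have "0 < 1 - b" using b(2) by simp
      ultimately show ?thesis by (rule prob_tendsto_one_mono[OF recovery, rotated])
    qed
    have "\<forall>n\<ge>1. credible n (p n) (q n) (c n) (D n)"
      using D by (auto simp: min_order_credible_def min_diam_credible_def)
    note both = prob_tendsto_one_Int[OF coverage[OF this] reach]
    show ?thesis
    proof (rule prob_tendsto_one_mono[OF both])
      show "\<forall>\<^sub>F n in sequentially.
          ({x. \<theta>0 n \<in> D n x} \<inter> {x. ?post n x {\<theta>0 n} \<ge> c n}) \<inter> set_pmf (?P n)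
          \<subseteq> {x. D n x = {\<theta>0 n}}"
        using eventually_ge_at_top[of 1]
      proof eventually_elim
        case (elim n)
        have "min_order_credible n (p n) (q n) (c n) (D n) \<or>
            min_diam_credible n (p n) (q n) (c n) (D n)"
          using D elim by blast
        from minimal_credible_eq_singleton[OF this assms(3)[OF elim]] show ?case by blast
      qed
    qed
  qed
  show ?thesis
    using coverage minimal by blast
qed

end
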